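(* Let $L\ge1$ be an integer, $m>0.5$ and $m_I>0$. Let $g_d,g_1,\dots,g_L$ be mutually independent random variables such that $g_d$ is a unit-mean Nakagami power random variable with parameter $m$ and $g_1,\dots,g_L$ are identically distributed unit-mean Nakagami power random variables with parameter $m_I$. Then the interference-limited error vector magnitude $\mathrm{EVM}=\mathbb{E}\left[\sqrt{\left(\sum_{l=1}^L g_l\right)/g_d}\right]$ satisfies $$\mathrm{EVM}=\frac{\Gamma(m-0.5)\,\Gamma(Lm_I+0.5)}{\Gamma(m)\,\Gamma(Lm_I)}\sqrt{\frac{m}{m_I}}.$$
   Context: Unit-mean Nakagami power random variable with parameter $m>0$: a Gamma random variable with shape $m$ and scale $1/m$, i.e. density $\frac{m^m x^{m-1}e^{-mx}}{\Gamma(m)}$, $x>0$. EVM: a desired signal with fading power $g_d$ is received together with $L$ interferers with fading powers $g_1,\dots,g_L$; with unit symbol energy, and in the absence of noise (interference-limited system), the error vector magnitude is $\mathrm{EVM}=\mathbb{E}\left[\sqrt{\left(\sum_{l=1}^L g_l\right)/g_d}\right]$. *)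

theory Defs
  imports "HOL-Probability.Probability"
begin

definition nakagami_power_density :: "real \<Rightarrow> real \<Rightarrow> real" where
  "nakagami_power_density m x =
    (if 0 < x then m powr m * x powr (m - 1) * exp (- m * x) / Gamma m else 0)"

definition nakagami_power :: "'a measure \<Rightarrow> real \<Rightarrow> ('a \<Rightarrow> real) \<Rightarrow> bool" where
  "nakagami_power M m X \<longleftrightarrow>
    distributed M lborel X (\<lambda>x. ennreal (nakagami_power_density m x))"

(* The Bochner integral of a non-integrable function is 0 by convention, so an equation
   "EVM M L gd g = c" with c > 0 entails that the expectation exists and is finite. *)
definition EVM :: "'a measure \<Rightarrow> nat \<Rightarrow> ('a \<Rightarrow> real) \<Rightarrow> (nat \<Rightarrow> 'a \<Rightarrow> real) \<Rightarrow> real" where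
  "EVM M L gd g = prob_space.expectation M (\<lambda>\<omega>. sqrt ((\<Sum>l=1..L. g l \<omega>) / gd \<omega>))"

(* Joint independence of gd, g 1, ..., g L: index 0 carries gd, overriding the unused g 0. *)
definition mutually_indep ::
  "'a measure \<Rightarrow> nat \<Rightarrow> ('a \<Rightarrow> real) \<Rightarrow> (nat \<Rightarrow> 'a \<Rightarrow> real) \<Rightarrow> bool" where
  "mutually_indep M L gd g \<longleftrightarrow>
    prob_space.indep_vars M (\<lambda>_. borel) (g(0 := gd)) {0..L}"

end

theory Submission
  imports Defs
begin

text \<open>
  Rescaling to mean one makes \<open>g\<^sub>1, \<dots>, g\<^sub>L\<close> Gamma variables with the common rate \<open>m\<^sub>I\<close>, so by
  the Beta integral their sum is again a Gamma variable, with shape \<open>L m\<^sub>I\<close> and rate \<open>m\<^sub>I\<close>. By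
  independence the expectation factors into the moment of order \<open>1/2\<close> of that sum and the moment
  of order \<open>-1/2\<close> of \<open>g\<^sub>d\<close>, and a Gamma variable of shape \<open>a\<close> and rate \<open>b\<close> has moment
  \<open>\<Gamma>(a + s) / (\<Gamma>(a) b\<^sup>s)\<close> of order \<open>s\<close> whenever \<open>a + s > 0\<close>.
\<close>

text \<open>Shape \<open>a\<close> and rate \<open>b\<close> are kept apart because the sum of the
  interferers has shape \<open>L * mI\<close> but still rate \<open>mI\<close>, and so leaves the
  unit-mean family when \<open>L > 1\<close>.\<close>

definition gamma_density :: "real \<Rightarrow> real \<Rightarrow> real \<Rightarrow> real" where
  "gamma_density a b x =
    (if 0 < x then b powr a * x powr (a - 1) * exp (- b * x) / Gamma a else 0)"

lemma nakagami_power_density_eq: "nakagami_power_density m = gamma_density m m"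
  by (auto simp: fun_eq_iff nakagami_power_density_def gamma_density_def)

lemma gamma_density_nonneg: "0 < a \<Longrightarrow> 0 \<le> gamma_density a b x"
  by (simp add: gamma_density_def Gamma_real_pos less_imp_le)

lemma borel_measurable_gamma_density [measurable]: "gamma_density a b \<in> borel_measurable borel"
  unfolding gamma_density_def[abs_def] by measurable

text \<open>The factor \<open>x powr s\<close> only raises the exponent from \<open>a - 1\<close> to
  \<open>a + s - 1\<close>, and the substitution \<open>t = b * x\<close> leads to Euler's integral
  for \<open>Gamma (a + s)\<close>. The nonnegative integral yields finiteness along with the
  value.\<close>

lemma nn_integral_gamma_density_powr:
  assumes a: "0 < a" and b: "0 < b" and s: "0 < a + s"
  shows "(\<integral>\<^sup>+x. ennreal (gamma_density a b x * x powr s) \<partial>lborel) =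
    ennreal (Gamma (a + s) / (Gamma a * b powr s))"
proof -
  have G: "0 < Gamma a" "0 < Gamma (a + s)"
    using a s by (simp_all add: Gamma_real_pos)
  let ?f = "\<lambda>t::real. indicator {0..} t * t powr (a + s - 1) / exp t"
  have "ennreal (Gamma (a + s)) = ennreal b * (\<integral>\<^sup>+x. ennreal (?f (b * x)) \<partial>lborel)"
    unfolding Gamma_conv_nn_integral_real[OF s]
    using b by (subst nn_integral_real_affine[where c=b and t=0]) auto
  then have "ennreal (1 / (Gamma a * b powr s)) * ennreal (Gamma (a + s)) =
    (\<integral>\<^sup>+x. ennreal (1 / (Gamma a * b powr s)) * (ennreal b * ennreal (?f (b * x))) \<partial>lborel)"
    by (simp add: nn_integral_cmult)
  also have "\<dots> = (\<integral>\<^sup>+x. ennreal (gamma_density a b x * x powr s) \<partial>lborel)"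
  proof (intro nn_integral_cong)
    fix x :: real
    have "1 / (Gamma a * b powr s) * (b * ?f (b * x)) = gamma_density a b x * x powr s"
    proof (cases "0 < x")
      case True
      have "x powr (a - 1) * x powr s = x powr (a + s - 1)"
        by (simp add: algebra_simps flip: powr_add)
      moreover have "b * b powr (a + s - 1) = b powr a * b powr s"
        using b by (simp add: powr_mult_base flip: powr_add)
      ultimately show ?thesis
        using True b G by (simp add: gamma_density_def powr_mult exp_minus divide_simps) (simp add: mult_ac)
    next
      \<comment> \<open>The indicator includes the endpoint 0, where the left side vanishes because
        \<open>0 powr _ = 0\<close>.\<close>
      case False
      then show ?thesis
        using b by (auto simp: gamma_density_def indicator_def zero_le_mult_iff)
    qed
    then show "ennreal (1 / (Gamma a * b powr s)) * (ennreal b * ennreal (?f (b * x))) =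
        ennreal (gamma_density a b x * x powr s)"
      using b G by (simp flip: ennreal_mult' ennreal_mult)
  qed
  finally show ?thesis
    using G by (simp flip: ennreal_mult')
qed

lemma has_bochner_integral_gamma_density_powr:
  assumes "0 < a" "0 < b" "0 < a + s"
  shows "has_bochner_integral lborel (\<lambda>x. gamma_density a b x * x powr s)
    (Gamma (a + s) / (Gamma a * b powr s))"
  using assms
  by (intro has_bochner_integral_nn_integral nn_integral_gamma_density_powr)
     (auto simp: gamma_density_nonneg Gamma_real_pos less_imp_le)

lemma nn_integral_Beta:
  fixes a b :: real
  assumes "0 < a" "0 < b"
  shows "(\<integral>\<^sup>+t. ennreal (indicator {0..1} t * (t powr (a - 1) * (1 - t) powr (b - 1))) \<partial>lborel) =
    ennreal (Beta a b)"
  using nn_integral_has_integral_lebesgue[OF _ has_integral_Beta_real[OF assms]] by simp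

text \<open>Since the rates agree, the exponentials multiply to \<open>exp (- b * x)\<close>, free
  of \<open>y\<close>. Scaling \<open>y = x * t\<close> then leaves a Beta integral in
  \<open>t\<close>.\<close>

lemma convolution_gamma_density:
  assumes a: "0 < a" "0 < a'" and b: "0 < b"
  shows "(\<lambda>x. \<integral>\<^sup>+y. ennreal (gamma_density a b (x - y)) * ennreal (gamma_density a' b y) \<partial>lborel) =
    (\<lambda>x. ennreal (gamma_density (a + a') b x))"
proof
  fix x :: real
  let ?h = "\<lambda>y. gamma_density a b (x - y) * gamma_density a' b y"
  have mult: "(\<integral>\<^sup>+y. ennreal (gamma_density a b (x - y)) * ennreal (gamma_density a' b y) \<partial>lborel) =
      (\<integral>\<^sup>+y. ennreal (?h y) \<partial>lborel)"
    using a by (simp add: ennreal_mult gamma_density_nonneg)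
  have G: "0 < Gamma a" "0 < Gamma a'" "0 < Gamma (a + a')"
    using a by (simp_all add: Gamma_real_pos)
  show "(\<integral>\<^sup>+y. ennreal (gamma_density a b (x - y)) * ennreal (gamma_density a' b y) \<partial>lborel) =
    ennreal (gamma_density (a + a') b x)"
  proof (cases "0 < x")
    \<comment> \<open>For \<open>x \<le> 0\<close> the arguments \<open>x - y\<close> and
      \<open>y\<close> cannot both be positive.\<close>
    case False
    then have "?h y = 0" for y
      by (auto simp: gamma_density_def)
    then have "(\<integral>\<^sup>+y. ennreal (?h y) \<partial>lborel) = 0"
      by (simp only: ennreal_0 nn_integral_0_iff_AE) simp
    then show ?thesis
      using False by (simp add: mult) (simp add: gamma_density_def)
  next
    case x: True
    \<comment> \<open>\<open>C\<close> collects everything free of \<open>t\<close> after the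
      scaling. Its Gamma quotient is the reciprocal of \<open>Beta a' a\<close>, so the Beta
      integral will cancel it.\<close>
    define C where "C = Gamma (a + a') / (Gamma a * Gamma a') * gamma_density (a + a') b x"
    have C: "0 \<le> C"
      using a G by (simp add: C_def gamma_density_nonneg)
    have "(\<integral>\<^sup>+y. ennreal (?h y) \<partial>lborel) = (\<integral>\<^sup>+t. ennreal (x * ?h (x * t)) \<partial>lborel)"
    proof -
      have "(\<integral>\<^sup>+y. ennreal (?h y) \<partial>lborel) = ennreal x * (\<integral>\<^sup>+t. ennreal (?h (x * t)) \<partial>lborel)"
        using x nn_integral_real_affine[of "\<lambda>y. ennreal (?h y)" x 0] by simp
      also have "\<dots> = (\<integral>\<^sup>+t. ennreal x * ennreal (?h (x * t)) \<partial>lborel)"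
        by (rule nn_integral_cmult[symmetric]) measurable
      finally show ?thesis
        using x by (simp add: ennreal_mult' less_imp_le)
    qed
    also have "\<dots> = (\<integral>\<^sup>+t. ennreal C *
        ennreal (indicator {0..1} t * (t powr (a' - 1) * (1 - t) powr (a - 1))) \<partial>lborel)"
    proof (intro nn_integral_cong)
      fix t :: real
      have "x * ?h (x * t) = C * (indicator {0..1} t * (t powr (a' - 1) * (1 - t) powr (a - 1)))"
      proof (cases "0 < t \<and> t < 1")
        case True
        then have pos: "0 < x * t" "0 < x * (1 - t)"
          using x by simp_all
        have "x - x * t = x * (1 - t)"
          by (simp add: algebra_simps)
        then have "gamma_density a b (x - x * t) =
            b powr a * (x powr (a - 1) * (1 - t) powr (a - 1)) * exp (- b * (x - x * t)) / Gamma a"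
          using pos x True by (simp add: gamma_density_def powr_mult)
        moreover have "gamma_density a' b (x * t) =
            b powr a' * (x powr (a' - 1) * t powr (a' - 1)) * exp (- b * (x * t)) / Gamma a'"
          using pos x True by (simp add: gamma_density_def powr_mult)
        ultimately have "x * ?h (x * t) = (b powr a * b powr a') *
            (x * x powr (a - 1) * x powr (a' - 1)) *
            (exp (- b * (x - x * t)) * exp (- b * (x * t))) *
            (t powr (a' - 1) * (1 - t) powr (a - 1)) / (Gamma a * Gamma a')"
          by simp
        also have "b powr a * b powr a' = b powr (a + a')"
          by (simp add: powr_add)
        also have "x * x powr (a - 1) * x powr (a' - 1) = x powr (a + a' - 1)"
          using x by (simp add: powr_mult_base algebra_simps flip: powr_add)
        also have "exp (- b * (x - x * t)) * exp (- b * (x * t)) = exp (- b * x)"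
          by (simp add: algebra_simps flip: exp_add)
        finally show ?thesis
          using x G True by (simp add: C_def gamma_density_def)
      next
        \<comment> \<open>At the endpoints 0 and 1 of the closed indicator the right side is zero
          again by \<open>0 powr _ = 0\<close>.\<close>
        case False
        then have "t \<le> 0 \<or> 1 \<le> t" by auto
        then show ?thesis
          using x by (auto simp: gamma_density_def indicator_def zero_less_mult_iff)
      qed
      then show "ennreal (x * ?h (x * t)) =
          ennreal C * ennreal (indicator {0..1} t * (t powr (a' - 1) * (1 - t) powr (a - 1)))"
        using C by (simp flip: ennreal_mult')
    qed
    also have "\<dots> = ennreal (C * Beta a' a)"
      using a C by (simp add: nn_integral_cmult nn_integral_Beta ennreal_mult'[OF C])
    also have "C * Beta a' a = gamma_density (a + a') b x"
      using G by (simp add: C_def Beta_def add.commute)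
    finally show ?thesis
      by (simp add: mult)
  qed
qed

context prob_space
begin

lemma sum_indep_gamma:
  assumes "indep_var borel X borel Y" "0 < a" "0 < a'" "0 < b"
    and "distributed M lborel X (\<lambda>x. ennreal (gamma_density a b x))"
    and "distributed M lborel Y (\<lambda>x. ennreal (gamma_density a' b x))"
  shows "distributed M lborel (\<lambda>\<omega>. X \<omega> + Y \<omega>) (\<lambda>x. ennreal (gamma_density (a + a') b x))"
  using assms
  by (subst convolution_gamma_density[symmetric]) (auto intro!: distributed_convolution)

text \<open>Induction by convolving one summand at a time: the rate is common, so only the shapes
  add. It starts at a singleton because the empty sum is the constant 0, which has no
  density.\<close>

lemma gamma_distributed_sum:
  assumes "finite I" "I \<noteq> {}" and b: "0 < b" and "\<And>i. i \<in> I \<Longrightarrow> 0 < a i"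
    and "\<And>i. i \<in> I \<Longrightarrow> distributed M lborel (X i) (\<lambda>x. ennreal (gamma_density (a i) b x))"
    and "indep_vars (\<lambda>_. borel) X I"
  shows "distributed M lborel (\<lambda>\<omega>. \<Sum>i\<in>I. X i \<omega>)
    (\<lambda>x. ennreal (gamma_density (\<Sum>i\<in>I. a i) b x))"
  using assms(1,2,4-)
proof (induct rule: finite_ne_induct)
  case (singleton i)
  then show ?case by simp
next
  case (insert i I)
  have "distributed M lborel (\<lambda>\<omega>. X i \<omega> + (\<Sum>i\<in>I. X i \<omega>))
      (\<lambda>x. ennreal (gamma_density (a i + (\<Sum>i\<in>I. a i)) b x))"
  proof (rule sum_indep_gamma[OF indep_vars_sum])
    show "0 < (\<Sum>i\<in>I. a i)"
      using insert by (intro sum_pos) auto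
    show "distributed M lborel (\<lambda>\<omega>. \<Sum>i\<in>I. X i \<omega>)
        (\<lambda>x. ennreal (gamma_density (\<Sum>i\<in>I. a i) b x))"
      using insert.prems by (intro insert.hyps) (auto intro: indep_vars_subset)
  qed (use insert b in auto)
  then show ?case
    using insert by simp
qed

text \<open>The density vanishes off the positive axis, so \<open>f\<close> need only agree with the
  power there. This admits \<open>sqrt x\<close> and \<open>1 / sqrt x\<close> directly, whatever
  their values at other points.\<close>

lemma has_bochner_integral_gamma_distributed_powr:
  assumes X: "distributed M lborel X (\<lambda>x. ennreal (gamma_density a b x))"
    and a: "0 < a" "0 < b" "0 < a + s"
    and f: "f \<in> borel_measurable borel" "\<And>x. 0 < x \<Longrightarrow> f x = x powr s"
  shows "has_bochner_integral M (\<lambda>\<omega>. f (X \<omega>)) (Gamma (a + s) / (Gamma a * b powr s))"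
proof -
  have "(\<lambda>x. gamma_density a b x * f x) = (\<lambda>x. gamma_density a b x * x powr s)"
    using f(2) by (auto simp: gamma_density_def)
  then have "has_bochner_integral lborel (\<lambda>x. gamma_density a b x * f x)
      (Gamma (a + s) / (Gamma a * b powr s))"
    using has_bochner_integral_gamma_density_powr[OF a] by simp
  then show ?thesis
    using distributed_integrable[OF X, of f] distributed_integral[OF X, of f] a(1) f(1)
    by (simp add: has_bochner_integral_iff gamma_density_nonneg)
qed

end

theorem corollary4:
  fixes M :: "'a measure" and L :: nat and m mI :: real
    and gd :: "'a \<Rightarrow> real" and g :: "nat \<Rightarrow> 'a \<Rightarrow> real"
  assumes "prob_space M"
    and "L \<ge> 1" and "m > 1/2" and "mI > 0"
    and "mutually_indep M L gd g"
    and "nakagami_power M m gd"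
    and "\<And>l. l \<in> {1..L} \<Longrightarrow> nakagami_power M mI (g l)"
  shows "EVM M L gd g =
    Gamma (m - 1/2) * Gamma (real L * mI + 1/2) / (Gamma m * Gamma (real L * mI)) * sqrt (m / mI)"
proof -
  interpret prob_space M by fact
  let ?S = "\<lambda>\<omega>. \<Sum>l=1..L. g l \<omega>"
  have gd: "distributed M lborel gd (\<lambda>x. ennreal (gamma_density m m x))"
    using assms(6) by (simp add: nakagami_power_def nakagami_power_density_eq)
  have g: "distributed M lborel (g l) (\<lambda>x. ennreal (gamma_density mI mI x))" if "l \<in> {1..L}" for l
    using assms(7)[OF that] by (simp add: nakagami_power_def nakagami_power_density_eq)
  \<comment> \<open>Splitting off index 0 gives the form in which \<open>indep_vars_sum\<close>
    makes one variable independent of the sum of the others.\<close>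
  have "{0..L} = insert 0 {1..L}" by auto
  then have indep: "indep_vars (\<lambda>_. borel) (g(0 := gd)) (insert 0 {1..L})"
    using assms(5) by (simp add: mutually_indep_def)
  then have "indep_vars (\<lambda>_. borel) (g(0 := gd)) {1..L}"
    by (rule indep_vars_subset) auto
  \<comment> \<open>The update at 0 is invisible on \<open>{1..L}\<close>.\<close>
  then have "indep_vars (\<lambda>_. borel) g {1..L}"
    by (rule indep_vars_cong[THEN iffD1, rotated -1]) auto
  then have S: "distributed M lborel ?S (\<lambda>x. ennreal (gamma_density (real L * mI) mI x))"
    using gamma_distributed_sum[of "{1..L}" mI "\<lambda>_. mI" g] assms(2,4) g by simp
  have "(\<lambda>\<omega>. \<Sum>l=1..L. (g(0 := gd)) l \<omega>) = ?S"
    by (intro ext sum.cong) auto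
  then have "indep_var borel gd borel ?S"
    using indep_vars_sum[OF _ _ indep] by simp
  then have "indep_var borel ((\<lambda>x. 1 / sqrt x) \<circ> gd) borel (sqrt \<circ> ?S)"
    by (rule indep_var_compose) simp_all
  then have ind: "indep_var borel (\<lambda>\<omega>. 1 / sqrt (gd \<omega>)) borel (\<lambda>\<omega>. sqrt (?S \<omega>))"
    by (simp add: comp_def)
  \<comment> \<open>The moment of order \<open>-1/2\<close>: the condition \<open>0 < a + s\<close>
    becomes \<open>m > 1/2\<close>.\<close>
  have D: "has_bochner_integral M (\<lambda>\<omega>. 1 / sqrt (gd \<omega>))
      (Gamma (m + - (1/2)) / (Gamma m * m powr - (1/2)))"
    using assms(3) by (intro has_bochner_integral_gamma_distributed_powr[OF gd])
      (simp_all add: powr_minus_divide powr_half_sqrt)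
  have N: "has_bochner_integral M (\<lambda>\<omega>. sqrt (?S \<omega>))
      (Gamma (real L * mI + 1/2) / (Gamma (real L * mI) * mI powr (1/2)))"
    using assms(2,4) by (intro has_bochner_integral_gamma_distributed_powr[OF S])
      (simp_all add: powr_half_sqrt add_pos_pos)
  \<comment> \<open>\<open>real_sqrt_divide\<close> holds for all reals, so the quotient splits
    pointwise, without an almost-everywhere argument about the sign of \<open>gd\<close>.\<close>
  have "EVM M L gd g = expectation (\<lambda>\<omega>. 1 / sqrt (gd \<omega>) * sqrt (?S \<omega>))"
    by (simp add: EVM_def real_sqrt_divide)
  \<comment> \<open>The product rule for independent variables needs both factors integrable, which
    \<open>D\<close> and \<open>N\<close> provide besides the values.\<close>
  also have "\<dots> = expectation (\<lambda>\<omega>. 1 / sqrt (gd \<omega>)) * expectation (\<lambda>\<omega>. sqrt (?S \<omega>))"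
    using D N by (intro indep_var_lebesgue_integral[OF ind]) (auto simp: has_bochner_integral_iff)
  also have "\<dots> = Gamma (m + - (1/2)) / (Gamma m * m powr - (1/2)) *
      (Gamma (real L * mI + 1/2) / (Gamma (real L * mI) * mI powr (1/2)))"
    using D N by (simp add: has_bochner_integral_integral_eq)
  \<comment> \<open>The negative power of \<open>m\<close> in the denominator puts
    \<open>sqrt m\<close> on top, and \<open>mI powr (1/2)\<close> supplies the
    \<open>sqrt mI\<close> below.\<close>
  also have "\<dots> = Gamma (m - 1/2) * Gamma (real L * mI + 1/2) / (Gamma m * Gamma (real L * mI)) *
      sqrt (m / mI)"
    using assms(3,4) by (simp add: powr_minus_divide powr_half_sqrt real_sqrt_divide mult_ac)
  finally show ?thesis .
qed

end
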